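(* Let $((A,[,]),N)$ be an $S$-adjoint-admissible Nijenhuis left Alia algebra over $K$, where $S:A\to A$ is linear, and let $r=\sum_i a_i\otimes b_i\in A\otimes A$ be an antisymmetric solution of the $S$-admissible left Alia Yang-Baxter equation in $((A,[,]),N)$. Then $((A,[,],\Delta),N,S)$ is a Nijenhuis left Alia bialgebra, where $\Delta=\Delta_r:A\to A\otimes A$ is defined by $\Delta_r(x)=\sum_i\big(([a_i,x]-[x,a_i])\otimes b_i-a_i\otimes[b_i,x]\big)$.
   Context: All vector spaces are over a field $K$ of characteristic zero; $\tau$ is the flip map; $r$ is antisymmetric if $r+\tau(r)=0$. A left Alia algebra is $(A,[,])$ with $[,]$ bilinear and $[[x,y],z]+[[y,z],x]+[[z,x],y]=[[y,x],z]+[[z,y],x]+[[x,z],y]$. A Nijenhuis left Alia algebra $((A,[,]),N)$ has in addition a linear map $N$ with $[N(x),N(y)]+N^2([x,y])=N([N(x),y]+[x,N(y)])$. It is $S$-adjoint-admissible if for all $x,y\in A$ $$S[N(x),y]+[x,S^2(y)]=S[x,S(y)]+[N(x),S(y)],\qquad S[x,N(y)]+[S^2(x),y]=S[S(x),y]+[S(x),N(y)].$$ The $S$-admissible left Alia Yang-Baxter equation in $((A,[,]),N)$ is the pair of equations $$\sum_{i,j}\big([a_i,a_j]\otimes b_i\otimes b_j+a_i\otimes([a_j,b_i]-[b_i,a_j])\otimes b_j-a_i\otimes a_j\otimes[b_j,b_i]\big)=0,\qquad (S\otimes\mathrm{id}-\mathrm{id}\otimes N)(r)=0.$$ Write $\Delta(x)=x_{(1)}\otimes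 x_{(2)}$ (Sweedler notation). A left Alia coalgebra is $(A,\Delta)$ with $$x_{(1)(2)}\otimes x_{(1)(1)}\otimes x_{(2)}+x_{(1)(1)}\otimes x_{(2)}\otimes x_{(1)(2)}+x_{(2)}\otimes x_{(1)(2)}\otimes x_{(1)(1)}=x_{(1)(1)}\otimes x_{(1)(2)}\otimes x_{(2)}+x_{(1)(2)}\otimes x_{(2)}\otimes x_{(1)(1)}+x_{(2)}\otimes x_{(1)(1)}\otimes x_{(1)(2)},$$ where $x_{(1)(1)}\otimes x_{(1)(2)}\otimes x_{(2)}=(\Delta\otimes\mathrm{id})\Delta(x)$. A left Alia bialgebra is $(A,[,],\Delta)$ with $(A,[,])$ a left Alia algebra, $(A,\Delta)$ a left Alia coalgebra and $(\tau-\mathrm{id}^{\otimes 2})(\Delta([x,y]-[y,x]))=(\tau-\mathrm{id}^{\otimes 2})((\mathcal R(y)\otimes\mathrm{id})\Delta(x)-(\mathcal R(x)\otimes\mathrm{id})\Delta(y))$, where $\mathcal R(y)z=[z,y]$. A Nijenhuis left Alia bialgebra $((A,[,],\Delta),N,S)$ is a left Alia bialgebra such that $((A,[,]),N)$ is an $S$-adjoint-admissible Nijenhuis left Alia algebra and for all $x\in A$: $S(x_{(1)})\otimes S(x_{(2)})+S^2(x)_{(1)}\otimes S^2(x)_{(2)}=S(S(x)_{(1)})\otimes S(x)_{(2)}+S(x)_{(1)}\otimes S(S(x)_{(2)})$; $S(N(x)_{(1)})\otimes N(x)_{(2)}+x_{(1)}\otimes N^2(x_{(2)})=S(x_{(1)})\otimes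 N(x_{(2)})+N(x)_{(1)}\otimes N(N(x)_{(2)})$; $N(x)_{(1)}\otimes S(N(x)_{(2)})+N^2(x_{(1)})\otimes x_{(2)}=N(x_{(1)})\otimes S(x_{(2)})+N(N(x)_{(1)})\otimes N(x)_{(2)}$. *)

theory Defs
  imports Complex_Main "HOL-Library.Function_Algebras"
begin

section \<open>Bilinear and trilinear maps\<close>

definition bilinear_map ::
  "('k::field \<Rightarrow> 'a::ab_group_add \<Rightarrow> 'a) \<Rightarrow> ('k \<Rightarrow> 'c::ab_group_add \<Rightarrow> 'c)
    \<Rightarrow> ('a \<Rightarrow> 'a \<Rightarrow> 'c) \<Rightarrow> bool"
  where "bilinear_map s t f \<longleftrightarrow>
    (\<forall>x. Vector_Spaces.linear s t (\<lambda>y. f x y)) \<and> (\<forall>y. Vector_Spaces.linear s t (\<lambda>x. f x y))"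

definition trilinear_map ::
  "('k::field \<Rightarrow> 'a::ab_group_add \<Rightarrow> 'a) \<Rightarrow> ('k \<Rightarrow> 'c::ab_group_add \<Rightarrow> 'c)
    \<Rightarrow> ('a \<Rightarrow> 'a \<Rightarrow> 'a \<Rightarrow> 'c) \<Rightarrow> bool"
  where "trilinear_map s t f \<longleftrightarrow>
    (\<forall>y z. Vector_Spaces.linear s t (\<lambda>x. f x y z)) \<and>
    (\<forall>x z. Vector_Spaces.linear s t (\<lambda>y. f x y z)) \<and>
    (\<forall>x y. Vector_Spaces.linear s t (\<lambda>z. f x y z))"


section \<open>Tensor squares and cubes of a vector space\<close>

text \<open>
  The scalar multiplication \<open>s\<close> of a vector space is a term, so the quotient of the free vector
  space by the bilinearity relations (which mention \<open>s\<close>) is not available as a type. We use the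
  following concrete model of the tensor square: \<open>a \<otimes> b\<close> is evaluation of bilinear forms at
  \<open>(a, b)\<close>, and the tensor square is the linear span of these functionals. The functionals are
  total on \<open>'a \<Rightarrow> 'a \<Rightarrow> 'k\<close> and vanish on functions that are not bilinear, so that equality of
  tensors is equality in HOL. The tensor cube is modelled in the same way with trilinear forms.
  The universal properties with respect to arbitrary target vector spaces are proved below, so
  these are the usual tensor products, in any dimension.
\<close>

type_synonym ('a, 'k) tensor2 = "('a \<Rightarrow> 'a \<Rightarrow> 'k) \<Rightarrow> 'k"
type_synonym ('a, 'k) tensor3 = "('a \<Rightarrow> 'a \<Rightarrow> 'a \<Rightarrow> 'k) \<Rightarrow> 'k"

definition fscale :: "'k::field \<Rightarrow> ('f \<Rightarrow> 'k) \<Rightarrow> ('f \<Rightarrow> 'k)"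
  where "fscale c \<phi> = (\<lambda>\<beta>. c * \<phi> \<beta>)"

definition tens2 :: "('k::field \<Rightarrow> 'a::ab_group_add \<Rightarrow> 'a) \<Rightarrow> 'a \<Rightarrow> 'a \<Rightarrow> ('a, 'k) tensor2"
  where "tens2 s a b = (\<lambda>\<beta>. if bilinear_map s (*) \<beta> then \<beta> a b else 0)"

definition tens3 ::
  "('k::field \<Rightarrow> 'a::ab_group_add \<Rightarrow> 'a) \<Rightarrow> 'a \<Rightarrow> 'a \<Rightarrow> 'a \<Rightarrow> ('a, 'k) tensor3"
  where "tens3 s a b c = (\<lambda>\<gamma>. if trilinear_map s (*) \<gamma> then \<gamma> a b c else 0)"

definition tensor2_space ::
  "('k::field \<Rightarrow> 'a::ab_group_add \<Rightarrow> 'a) \<Rightarrow> ('a, 'k) tensor2 set"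
  where "tensor2_space s = module.span fscale {tens2 s a b | a b. True}"

definition tensor3_space ::
  "('k::field \<Rightarrow> 'a::ab_group_add \<Rightarrow> 'a) \<Rightarrow> ('a, 'k) tensor3 set"
  where "tensor3_space s = module.span fscale {tens3 s a b c | a b c. True}"

text \<open>
  Linear extension of a bilinear map \<open>F\<close> on pairs with values in a space of functionals, such as
  a tensor square or cube, to the tensor square (lemma \<open>ext2_tens2\<close>). In Sweedler notation,
  \<open>ext2 (\<lambda>x1 x2. E x1 x2) (\<Delta> x)\<close> is the expression \<open>E x\<^sub>(\<^sub>1\<^sub>) x\<^sub>(\<^sub>2\<^sub>)\<close>.
\<close>

definition ext2 :: "('a \<Rightarrow> 'a \<Rightarrow> ('f \<Rightarrow> 'k)) \<Rightarrow> ('a, 'k) tensor2 \<Rightarrow> ('f \<Rightarrow> 'k)"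
  where "ext2 F \<phi> = (\<lambda>\<beta>. \<phi> (\<lambda>a b. F a b \<beta>))"

definition flip ::
  "('k::field \<Rightarrow> 'a::ab_group_add \<Rightarrow> 'a) \<Rightarrow> ('a, 'k) tensor2 \<Rightarrow> ('a, 'k) tensor2"
  where "flip s = ext2 (\<lambda>a b. tens2 s b a)"

definition tensor_map ::
  "('k::field \<Rightarrow> 'a::ab_group_add \<Rightarrow> 'a) \<Rightarrow> ('a \<Rightarrow> 'a) \<Rightarrow> ('a \<Rightarrow> 'a)
    \<Rightarrow> ('a, 'k) tensor2 \<Rightarrow> ('a, 'k) tensor2"
  where "tensor_map s f g = ext2 (\<lambda>a b. tens2 s (f a) (g b))"


subsection \<open>Validation of the model\<close>

lemma vector_space_fscale: "vector_space fscale"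
  by unfold_locales (auto simp: fscale_def fun_eq_iff algebra_simps)

lemma linear_iff:
  "Vector_Spaces.linear s t f \<longleftrightarrow> vector_space s \<and> vector_space t \<and>
    (\<forall>x y. f (x + y) = f x + f y) \<and> (\<forall>c x. f (s c x) = t c (f x))"
  unfolding Vector_Spaces.linear_def module_hom_def module_hom_axioms_def
  by (auto simp: vector_space_def module_def)

lemma vector_space_field: "vector_space ((*) :: 'k::field \<Rightarrow> 'k \<Rightarrow> 'k)"
  by unfold_locales (auto simp: algebra_simps)

lemma separating_form:
  assumes "vector_space t" and "\<And>l. Vector_Spaces.linear t (*) l \<Longrightarrow> l z = l w"
  shows "z = w"
proof (rule ccontr)
  assume "z \<noteq> w"
  interpret V: vector_space t by fact
  interpret K: vector_space "(*)" by (rule vector_space_field)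
  interpret P: vector_space_pair t "(*)" ..
  have "V.independent {z - w}" using \<open>z \<noteq> w\<close> by simp
  from P.linear_independent_extend[OF this, of "\<lambda>_. 1"]
  obtain l where l: "Vector_Spaces.linear t (*) l" "l (z - w) = 1" by auto
  have "l z = l (z - w) + l w" using l(1) unfolding linear_iff by (metis diff_add_cancel)
  then show False using assms(2)[OF l(1)] l(2) by simp
qed

lemma bilinear_tens2:
  assumes "vector_space s"
  shows "bilinear_map s fscale (tens2 s)"
  unfolding bilinear_map_def linear_iff
  using assms vector_space_fscale
  by (auto simp: tens2_def fscale_def fun_eq_iff bilinear_map_def linear_iff)

lemma trilinear_tens3:
  assumes "vector_space s"
  shows "trilinear_map s fscale (tens3 s)"
  unfolding trilinear_map_def linear_iff
  using assms vector_space_fscale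
  by (auto simp: tens3_def fscale_def fun_eq_iff trilinear_map_def linear_iff)

definition linear_on_span ::
  "('k \<Rightarrow> 'a::ab_group_add \<Rightarrow> 'a) \<Rightarrow> ('k \<Rightarrow> 'c::ab_group_add \<Rightarrow> 'c)
    \<Rightarrow> 'a set \<Rightarrow> ('a \<Rightarrow> 'c) \<Rightarrow> bool"
  where "linear_on_span s t V L \<longleftrightarrow>
    (\<forall>u\<in>V. \<forall>v\<in>V. L (u + v) = L u + L v) \<and> (\<forall>c. \<forall>u\<in>V. L (s c u) = t c (L u))"

lemma linear_on_span_unique:
  assumes "vector_space s" and "vector_space t"
    and L: "linear_on_span s t (module.span s B) L" and L': "linear_on_span s t (module.span s B) L'"
    and eq: "\<And>b. b \<in> B \<Longrightarrow> L b = L' b" and "u \<in> module.span s B"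
  shows "L u = L' u"
proof -
  interpret V: vector_space s by fact
  interpret W: vector_space t by fact
  note ** = L[unfolded linear_on_span_def] L'[unfolded linear_on_span_def]
  have zero: "L 0 = 0" "L' 0 = 0"
    using ** V.span_zero by (metis V.scale_zero_left W.scale_zero_left)+
  have "u \<in> V.span B \<and> L u = L' u"
    using \<open>u \<in> module.span s B\<close>
  proof (induction rule: V.span_induct_alt)
    case base
    then show ?case using zero V.span_zero by simp
  next
    case (step c x y)
    have x: "x \<in> V.span B" using step(1) by (rule V.span_base)
    have "s c x \<in> V.span B" using x by (rule V.span_scale)
    then show ?case using step ** x eq by (auto intro: V.span_add)
  qed
  then show ?thesis by simp
qed

lemma universal_aux:
  fixes t :: "'k::field \<Rightarrow> 'c::ab_group_add \<Rightarrow> 'c" and E :: "'x \<Rightarrow> 'f \<Rightarrow> 'k"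
  assumes t: "vector_space t"
    and E: "\<forall>l x. Vector_Spaces.linear t (*) l \<longrightarrow> E x (pull l) = l (h x)"
  shows "\<exists>L. linear_on_span fscale t (module.span fscale (range E)) L \<and> (\<forall>x. L (E x) = h x)"
proof -
  interpret V: vector_space "fscale :: 'k \<Rightarrow> ('f \<Rightarrow> 'k) \<Rightarrow> _" by (rule vector_space_fscale)
  interpret W: vector_space t by fact
  define Q where "Q \<phi> z \<longleftrightarrow> (\<forall>l. Vector_Spaces.linear t (*) l \<longrightarrow> \<phi> (pull l) = l z)" for \<phi> z
  have uniq: "z = w" if "Q \<phi> z" "Q \<phi> w" for \<phi> z w
    using separating_form[OF t, of z w] that unfolding Q_def by metis
  define L where "L \<phi> = (THE z. Q \<phi> z)" for \<phi>
  have L: "L \<phi> = z" if "Q \<phi> z" for \<phi> z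
    unfolding L_def using that uniq by blast
  have add: "Q (\<phi> + \<psi>) (z + w)" if "Q \<phi> z" "Q \<psi> w" for \<phi> \<psi> z w
    using that unfolding Q_def linear_iff by auto
  have sc: "Q (fscale c \<phi>) (t c z)" if "Q \<phi> z" for c \<phi> z
    using that unfolding Q_def linear_iff by (auto simp: fscale_def)
  have base: "Q (E x) (h x)" for x unfolding Q_def using E by blast
  have zero: "Q 0 0"
    unfolding Q_def linear_iff by (metis W.scale_zero_left mult_zero_left zero_fun_apply)
  have ex: "\<exists>z. Q \<phi> z" if "\<phi> \<in> V.span (range E)" for \<phi>
    using that
  proof (induction rule: V.span_induct_alt)
    case base
    then show ?case using zero by blast
  next
    case (step c x y)
    then show ?case using add sc base by blast
  qed
  have "linear_on_span fscale t (V.span (range E)) L"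
    unfolding linear_on_span_def using ex L add sc by metis
  moreover have "\<forall>x. L (E x) = h x" using L base by blast
  ultimately show ?thesis by blast
qed

lemma tensor2_space_range: "tensor2_space s = module.span fscale (range (\<lambda>(a, b). tens2 s a b))"
  unfolding tensor2_space_def by (rule arg_cong[where f = "module.span fscale"]) auto

lemma tensor3_space_range:
  "tensor3_space s = module.span fscale (range (\<lambda>(a, b, c). tens3 s a b c))"
  unfolding tensor3_space_def by (rule arg_cong[where f = "module.span fscale"]) (force simp: image_iff)

theorem tensor2_universal_exists:
  assumes h: "bilinear_map s t h"
  shows "\<exists>L. linear_on_span fscale t (tensor2_space s) L \<and> (\<forall>a b. L (tens2 s a b) = h a b)"
proof -
  have t: "vector_space t" using h by (auto simp: bilinear_map_def linear_iff)
  have "bilinear_map s (*) (\<lambda>a b. l (h a b))" if "Vector_Spaces.linear t (*) l" for l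
    using h that by (auto simp: bilinear_map_def linear_iff)
  then have "\<forall>l x. Vector_Spaces.linear t (*) l \<longrightarrow>
      (\<lambda>(a, b). tens2 s a b) x (\<lambda>a b. l (h a b)) = l ((\<lambda>(a, b). h a b) x)"
    by (auto simp: tens2_def)
  then have "\<exists>L. linear_on_span fscale t (tensor2_space s) L \<and>
      (\<forall>x. L ((\<lambda>(a, b). tens2 s a b) x) = (\<lambda>(a, b). h a b) x)"
    unfolding tensor2_space_range by (rule universal_aux[OF t, where pull = "\<lambda>l a b. l (h a b)"
        and E = "\<lambda>(a, b). tens2 s a b" and h = "\<lambda>(a, b). h a b"])
  then obtain L where L: "linear_on_span fscale t (tensor2_space s) L"
      "\<forall>x. L ((\<lambda>(a, b). tens2 s a b) x) = (\<lambda>(a, b). h a b) x"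
    by (elim exE conjE)
  have "L (tens2 s a b) = h a b" for a b
    using L(2)[THEN spec, of "(a, b)"] by (simp only: prod.case)
  with L(1)
  show "\<exists>L. linear_on_span fscale t (tensor2_space s) L \<and> (\<forall>a b. L (tens2 s a b) = h a b)"
    by (intro exI[of _ L] conjI allI)
qed

theorem tensor2_universal_unique:
  assumes h: "bilinear_map s t h"
    and L: "linear_on_span fscale t (tensor2_space s) L" "\<forall>a b. L (tens2 s a b) = h a b"
    and L': "linear_on_span fscale t (tensor2_space s) L'" "\<forall>a b. L' (tens2 s a b) = h a b"
    and u: "u \<in> tensor2_space s"
  shows "L u = L' u"
proof -
  have t: "vector_space t" using h by (auto simp: bilinear_map_def linear_iff)
  have "L x = L' x" if "x \<in> {tens2 s a b | a b. True}" for x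
    using that L(2) L'(2) by auto
  then show ?thesis
    using linear_on_span_unique[OF vector_space_fscale t, of "{tens2 s a b | a b. True}" L L' u]
      L(1) L'(1) u unfolding tensor2_space_def by blast
qed

theorem tensor3_universal_exists:
  assumes h: "trilinear_map s t h"
  shows "\<exists>L. linear_on_span fscale t (tensor3_space s) L \<and> (\<forall>a b c. L (tens3 s a b c) = h a b c)"
proof -
  have t: "vector_space t" using h by (auto simp: trilinear_map_def linear_iff)
  have "trilinear_map s (*) (\<lambda>a b c. l (h a b c))" if "Vector_Spaces.linear t (*) l" for l
    using h that by (auto simp: trilinear_map_def linear_iff)
  then have "\<forall>l x. Vector_Spaces.linear t (*) l \<longrightarrow>
      (\<lambda>(a, b, c). tens3 s a b c) x (\<lambda>a b c. l (h a b c)) = l ((\<lambda>(a, b, c). h a b c) x)"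
    by (auto simp: tens3_def)
  then have "\<exists>L. linear_on_span fscale t (tensor3_space s) L \<and>
      (\<forall>x. L ((\<lambda>(a, b, c). tens3 s a b c) x) = (\<lambda>(a, b, c). h a b c) x)"
    unfolding tensor3_space_range by (rule universal_aux[OF t, where pull = "\<lambda>l a b c. l (h a b c)"
        and E = "\<lambda>(a, b, c). tens3 s a b c" and h = "\<lambda>(a, b, c). h a b c"])
  then obtain L where L: "linear_on_span fscale t (tensor3_space s) L"
      "\<forall>x. L ((\<lambda>(a, b, c). tens3 s a b c) x) = (\<lambda>(a, b, c). h a b c) x"
    by (elim exE conjE)
  have "L (tens3 s a b c) = h a b c" for a b c
    using L(2)[THEN spec, of "(a, b, c)"] by (simp only: prod.case)
  with L(1)
  show "\<exists>L. linear_on_span fscale t (tensor3_space s) L \<and> (\<forall>a b c. L (tens3 s a b c) = h a b c)"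
    by (intro exI[of _ L] conjI allI)
qed

theorem tensor3_universal_unique:
  assumes h: "trilinear_map s t h"
    and L: "linear_on_span fscale t (tensor3_space s) L" "\<forall>a b c. L (tens3 s a b c) = h a b c"
    and L': "linear_on_span fscale t (tensor3_space s) L'" "\<forall>a b c. L' (tens3 s a b c) = h a b c"
    and u: "u \<in> tensor3_space s"
  shows "L u = L' u"
proof -
  have t: "vector_space t" using h by (auto simp: trilinear_map_def linear_iff)
  have "L x = L' x" if "x \<in> {tens3 s a b c | a b c. True}" for x
    using that L(2) L'(2) by auto
  then show ?thesis
    using linear_on_span_unique[OF vector_space_fscale t, of "{tens3 s a b c | a b c. True}" L L' u]
      L(1) L'(1) u unfolding tensor3_space_def by blast
qed

lemma ext2_tens2:
  assumes "bilinear_map s fscale F"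
  shows "ext2 F (tens2 s a b) = F a b"
proof
  fix \<beta>
  have "bilinear_map s (*) (\<lambda>a b. F a b \<beta>)"
    using assms vector_space_field by (auto simp: bilinear_map_def linear_iff fscale_def)
  then show "ext2 F (tens2 s a b) \<beta> = F a b \<beta>" by (simp add: ext2_def tens2_def)
qed

lemma ext2_linear: "Vector_Spaces.linear fscale fscale (ext2 F)"
  unfolding linear_iff by (simp add: vector_space_fscale ext2_def fscale_def fun_eq_iff)

lemma flip_tens2:
  assumes "vector_space s"
  shows "flip s (tens2 s a b) = tens2 s b a"
  unfolding flip_def
  by (rule ext2_tens2) (use bilinear_tens2[OF assms] in \<open>auto simp: bilinear_map_def\<close>)

lemma tensor_map_tens2:
  assumes "Vector_Spaces.linear s s f" and "Vector_Spaces.linear s s g"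
  shows "tensor_map s f g (tens2 s a b) = tens2 s (f a) (g b)"
proof -
  have "vector_space s" using assms by (simp add: linear_iff)
  from bilinear_tens2[OF this] show ?thesis
    unfolding tensor_map_def using assms
    by (intro ext2_tens2) (auto simp: bilinear_map_def linear_iff)
qed


section \<open>Nijenhuis left Alia algebras\<close>

locale left_alia_algebra = vector_space scale
  for scale :: "'k::field_char_0 \<Rightarrow> 'a::ab_group_add \<Rightarrow> 'a" +
  fixes br :: "'a \<Rightarrow> 'a \<Rightarrow> 'a"
  assumes br_bilinear: "bilinear_map scale scale br"
    and left_alia: "br (br x y) z + br (br y z) x + br (br z x) y
                  = br (br y x) z + br (br z y) x + br (br x z) y"

locale nijenhuis_left_alia_algebra = left_alia_algebra scale br
  for scale :: "'k::field_char_0 \<Rightarrow> 'a::ab_group_add \<Rightarrow> 'a" and br +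
  fixes N :: "'a \<Rightarrow> 'a"
  assumes N_linear: "Vector_Spaces.linear scale scale N"
    and nijenhuis: "br (N x) (N y) + N (N (br x y)) = N (br (N x) y + br x (N y))"

locale adjoint_admissible_nijenhuis_left_alia_algebra =
  nijenhuis_left_alia_algebra scale br N
  for scale :: "'k::field_char_0 \<Rightarrow> 'a::ab_group_add \<Rightarrow> 'a" and br N +
  fixes S :: "'a \<Rightarrow> 'a"
  assumes S_linear: "Vector_Spaces.linear scale scale S"
    and admissible_left: "S (br (N x) y) + br x (S (S y)) = S (br x (S y)) + br (N x) (S y)"
    and admissible_right: "S (br x (N y)) + br (S (S x)) y = S (br (S x) y) + br (S x) (N y)"


section \<open>Nijenhuis left Alia bialgebras\<close>

locale left_alia_coalgebra = vector_space scale
  for scale :: "'k::field_char_0 \<Rightarrow> 'a::ab_group_add \<Rightarrow> 'a" +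
  fixes \<Delta> :: "'a \<Rightarrow> ('a, 'k) tensor2"
  assumes \<Delta>_in: "\<Delta> x \<in> tensor2_space scale"
    and \<Delta>_linear: "Vector_Spaces.linear scale fscale \<Delta>"
    and left_coalia:
      "ext2 (\<lambda>x1 x2. ext2 (\<lambda>x11 x12.
          tens3 scale x12 x11 x2 + tens3 scale x11 x2 x12 + tens3 scale x2 x12 x11) (\<Delta> x1)) (\<Delta> x)
     = ext2 (\<lambda>x1 x2. ext2 (\<lambda>x11 x12.
          tens3 scale x11 x12 x2 + tens3 scale x12 x2 x11 + tens3 scale x2 x11 x12) (\<Delta> x1)) (\<Delta> x)"

locale left_alia_bialgebra = left_alia_algebra scale br + left_alia_coalgebra scale \<Delta>
  for scale :: "'k::field_char_0 \<Rightarrow> 'a::ab_group_add \<Rightarrow> 'a" and br \<Delta> +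
  assumes compatible:
    "flip scale (\<Delta> (br x y - br y x)) - \<Delta> (br x y - br y x)
   = flip scale (tensor_map scale (\<lambda>z. br z y) id (\<Delta> x) - tensor_map scale (\<lambda>z. br z x) id (\<Delta> y))
     - (tensor_map scale (\<lambda>z. br z y) id (\<Delta> x) - tensor_map scale (\<lambda>z. br z x) id (\<Delta> y))"

locale nijenhuis_left_alia_bialgebra =
  left_alia_bialgebra scale br \<Delta> + adjoint_admissible_nijenhuis_left_alia_algebra scale br N S
  for scale :: "'k::field_char_0 \<Rightarrow> 'a::ab_group_add \<Rightarrow> 'a" and br \<Delta> N S +
  assumes conijenhuis:
      "ext2 (\<lambda>x1 x2. tens2 scale (S x1) (S x2)) (\<Delta> x) + \<Delta> (S (S x))
     = ext2 (\<lambda>x1 x2. tens2 scale (S x1) x2) (\<Delta> (S x))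
       + ext2 (\<lambda>x1 x2. tens2 scale x1 (S x2)) (\<Delta> (S x))"
    and coadmissible_left:
      "ext2 (\<lambda>x1 x2. tens2 scale (S x1) x2) (\<Delta> (N x))
       + ext2 (\<lambda>x1 x2. tens2 scale x1 (N (N x2))) (\<Delta> x)
     = ext2 (\<lambda>x1 x2. tens2 scale (S x1) (N x2)) (\<Delta> x)
       + ext2 (\<lambda>x1 x2. tens2 scale x1 (N x2)) (\<Delta> (N x))"
    and coadmissible_right:
      "ext2 (\<lambda>x1 x2. tens2 scale x1 (S x2)) (\<Delta> (N x))
       + ext2 (\<lambda>x1 x2. tens2 scale (N (N x1)) x2) (\<Delta> x)
     = ext2 (\<lambda>x1 x2. tens2 scale (N x1) (S x2)) (\<Delta> x)
       + ext2 (\<lambda>x1 x2. tens2 scale (N x1) x2) (\<Delta> (N x))"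


section \<open>The admissible Yang-Baxter equation\<close>

text \<open>A tensor \<open>r\<close> enters through a finite presentation \<open>r = \<Sum>i\<in>I. a i \<otimes> b i\<close>.\<close>

definition tensor_sum ::
  "('k::field \<Rightarrow> 'a::ab_group_add \<Rightarrow> 'a) \<Rightarrow> 'i set \<Rightarrow> ('i \<Rightarrow> 'a) \<Rightarrow> ('i \<Rightarrow> 'a) \<Rightarrow> ('a, 'k) tensor2"
  where "tensor_sum s I a b = (\<Sum>i\<in>I. tens2 s (a i) (b i))"

definition antisymmetric_tensor ::
  "('k::field \<Rightarrow> 'a::ab_group_add \<Rightarrow> 'a) \<Rightarrow> ('a, 'k) tensor2 \<Rightarrow> bool"
  where "antisymmetric_tensor s r \<longleftrightarrow> r + flip s r = 0"

definition admissible_alia_YBE ::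
  "('k::field \<Rightarrow> 'a::ab_group_add \<Rightarrow> 'a) \<Rightarrow> ('a \<Rightarrow> 'a \<Rightarrow> 'a) \<Rightarrow> ('a \<Rightarrow> 'a) \<Rightarrow> ('a \<Rightarrow> 'a)
    \<Rightarrow> 'i set \<Rightarrow> ('i \<Rightarrow> 'a) \<Rightarrow> ('i \<Rightarrow> 'a) \<Rightarrow> bool"
  where "admissible_alia_YBE s br N S I a b \<longleftrightarrow>
    (\<Sum>i\<in>I. \<Sum>j\<in>I.
        tens3 s (br (a i) (a j)) (b i) (b j)
      + tens3 s (a i) (br (a j) (b i) - br (b i) (a j)) (b j)
      - tens3 s (a i) (a j) (br (b j) (b i))) = 0 \<and>
    tensor_map s S id (tensor_sum s I a b) - tensor_map s id N (tensor_sum s I a b) = 0"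

definition coboundary ::
  "('k::field \<Rightarrow> 'a::ab_group_add \<Rightarrow> 'a) \<Rightarrow> ('a \<Rightarrow> 'a \<Rightarrow> 'a)
    \<Rightarrow> 'i set \<Rightarrow> ('i \<Rightarrow> 'a) \<Rightarrow> ('i \<Rightarrow> 'a) \<Rightarrow> 'a \<Rightarrow> ('a, 'k) tensor2"
  where "coboundary s br I a b x =
    (\<Sum>i\<in>I. tens2 s (br (a i) x - br x (a i)) (b i) - tens2 s (a i) (br (b i) x))"

end

theory Submission
  imports Defs
begin

text \<open>
  Write \<open>xy\<close> for the bracket, \<open>c(x,y) = xy - yx\<close> for its commutator and \<open>r = \<Sum> a \<otimes> b\<close>, so that
  \<open>\<Delta> x = \<Sum> c(a,x) \<otimes> b - a \<otimes> bx\<close>. Each hypothesis on \<open>r\<close> is an equality of tensors, and applying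
  a multilinear map to both sides turns it into a rewrite rule for sums over the presentation:
  \<^item> antisymmetry: \<open>\<Sum> F(b,a) = - \<Sum> F(a,b)\<close> (lemma \<open>skew\<close>);
  \<^item> intertwining: \<open>\<Sum> F(Sa,b) = \<Sum> F(a,Nb)\<close>, and with antisymmetry also
    \<open>\<Sum> F(Na,b) = \<Sum> F(a,Sb)\<close> (lemmas \<open>shift_S\<close> and \<open>shift_N\<close>);
  \<^item> the Yang-Baxter equation, evaluated on an arbitrary trilinear map
    (lemma \<open>yang_baxter_trilinear\<close>).

  The key simplification is \<open>(\<tau> - id)\<Delta> x = \<Sum> xa \<otimes> b + a \<otimes> xb\<close>. It computes one side of the
  compatibility condition; the other side becomes a similar sum once the legs of \<open>r\<close> are
  exchanged, and the two agree in each tensor factor by the left Alia identity, which in terms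
  of commutators reads \<open>c(x,y)z + c(y,z)x + c(z,x)y = 0\<close>.

  The difference of the two sides of the left Alia coalgebra axiom is the sum of the cyclic
  rotations of \<open>((\<tau> - id)\<Delta> \<otimes> id)\<Delta> x\<close>. Modulo rotation and antisymmetry, this has four
  terms; the left Alia identity merges two of them into one, and the three that are left are
  those of the Yang-Baxter equation, rotated once and multiplied on the right by \<open>x\<close> in one
  factor (lemma \<open>coboundary_left_coalia\<close>).

  In the three conditions on \<open>N\<close> and \<open>S\<close>, the shift rules bring every term into one of the forms
  \<open>\<Sum> f(a) \<otimes> b\<close> and \<open>\<Sum> a \<otimes> g(b)\<close>. The terms of the second form then agree by one of the
  Nijenhuis identity and the two admissibility identities, those of the first form by the
  commutator versions of these identities (lemma \<open>admissible_comm\<close>).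
\<close>

section \<open>Multilinear maps out of a vector space\<close>

lemma bilinear_map_iff:
  "bilinear_map s t F \<longleftrightarrow> vector_space s \<and> vector_space t \<and>
    (\<forall>u u' v. F (u + u') v = F u v + F u' v) \<and> (\<forall>c u v. F (s c u) v = t c (F u v)) \<and>
    (\<forall>u v v'. F u (v + v') = F u v + F u v') \<and> (\<forall>c u v. F u (s c v) = t c (F u v))"
  unfolding bilinear_map_def linear_iff by auto

lemma trilinear_map_iff:
  "trilinear_map s t T \<longleftrightarrow> vector_space s \<and> vector_space t \<and>
    (\<forall>u u' v w. T (u + u') v w = T u v w + T u' v w) \<and>
    (\<forall>c u v w. T (s c u) v w = t c (T u v w)) \<and>
    (\<forall>u v v' w. T u (v + v') w = T u v w + T u v' w) \<and>
    (\<forall>c u v w. T u (s c v) w = t c (T u v w)) \<and>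
    (\<forall>u v w w'. T u v (w + w') = T u v w + T u v w') \<and>
    (\<forall>c u v w. T u v (s c w) = t c (T u v w))"
  unfolding trilinear_map_def linear_iff by auto

lemma fscale_add: "fscale c (f + g) = fscale c f + fscale c g"
  and fscale_diff: "fscale c (f - g) = fscale c f - fscale c g"
  by (auto simp: fscale_def fun_eq_iff algebra_simps)

lemma fscale_sum: "fscale c (\<Sum>i\<in>I. h i) = (\<Sum>i\<in>I. fscale c (h i))"
  by (rule module_hom.sum[OF vector_space.linear_scale_self[OF vector_space_fscale,
        unfolded Vector_Spaces.linear_def, THEN conjunct2, THEN conjunct2]])

lemmas fscale_simps = fscale_add fscale_diff fscale_sum

lemma trilinear_map_diff:
  assumes "trilinear_map s t T"
  shows "T (u - u') v w = T u v w - T u' v w" "T u (v - v') w = T u v w - T u v' w"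
    "T u v (w - w') = T u v w - T u v w'"
proof -
  have *: "T (u + u') v w = T u v w + T u' v w" "T u (v + v') w = T u v w + T u v' w"
    "T u v (w + w') = T u v w + T u v w'" for u u' v v' w w'
    using assms by (simp_all add: trilinear_map_iff)
  show "T (u - u') v w = T u v w - T u' v w" "T u (v - v') w = T u v w - T u v' w"
    "T u v (w - w') = T u v w - T u v w'"
    using *(1)[of "u - u'" u'] *(2)[of _ "v - v'" v'] *(3)[of _ _ "w - w'" w']
    by (simp_all add: algebra_simps)
qed

lemma linear_sum:
  assumes "Vector_Spaces.linear s t f"
  shows "f (\<Sum>i\<in>I. g i) = (\<Sum>i\<in>I. f (g i))"
  using assms unfolding Vector_Spaces.linear_def by (blast intro: module_hom.sum)

lemma linear_diff:
  assumes "Vector_Spaces.linear s t f"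
  shows "f (x - y) = f x - f y"
  using assms unfolding Vector_Spaces.linear_def by (blast intro: module_hom.diff)

lemmas ext2_sum = linear_sum[OF ext2_linear]

lemmas ext2_diff = linear_diff[OF ext2_linear]

section \<open>Left Alia algebras\<close>

context left_alia_algebra
begin

abbreviation tensor (infixl "\<otimes>" 70)
  where "u \<otimes> v \<equiv> tens2 scale u v"

abbreviation comm :: "'a \<Rightarrow> 'a \<Rightarrow> 'a"
  where "comm x y \<equiv> br x y - br y x"

lemma vector_space_scale: "vector_space scale" ..

lemma br_simps:
  "br (x + y) z = br x z + br y z" "br x (y + z) = br x y + br x z"
  "br (x - y) z = br x z - br y z" "br x (y - z) = br x y - br x z"
  "br (scale c x) z = scale c (br x z)" "br x (scale c z) = scale c (br x z)"
proof -
  have *: "br (x + y) z = br x z + br y z" "br x (y + z) = br x y + br x z" for x y z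
    using br_bilinear unfolding bilinear_map_iff by auto
  show "br (x + y) z = br x z + br y z" "br x (y + z) = br x y + br x z"
    by (fact *)+
  show "br (x - y) z = br x z - br y z" "br x (y - z) = br x y - br x z"
    using *(1)[of "x - y" y z] *(2)[of x "y - z" z] by (simp_all add: algebra_simps)
  show "br (scale c x) z = scale c (br x z)" "br x (scale c z) = scale c (br x z)"
    using br_bilinear unfolding bilinear_map_iff by auto
qed

text \<open>
  In this form the left Alia axiom is a Jacobi-type identity that only involves right
  multiplications of commutators.
\<close>

lemma left_alia_comm: "br (comm x y) z + br (comm y z) x + br (comm z x) y = 0"
  using left_alia[of x y z] by (simp add: br_simps algebra_simps)

lemma tensor_simps:
  "(u + u') \<otimes> v = u \<otimes> v + u' \<otimes> v" "u \<otimes> (v + v') = u \<otimes> v + u \<otimes> v'"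
  "(u - u') \<otimes> v = u \<otimes> v - u' \<otimes> v" "u \<otimes> (v - v') = u \<otimes> v - u \<otimes> v'"
  "scale c u \<otimes> v = fscale c (u \<otimes> v)" "u \<otimes> scale c v = fscale c (u \<otimes> v)"
proof -
  have *: "(u + u') \<otimes> v = u \<otimes> v + u' \<otimes> v" "u \<otimes> (v + v') = u \<otimes> v + u \<otimes> v'" for u u' v v'
    using bilinear_tens2[OF vector_space_scale] unfolding bilinear_map_iff by blast+
  show "(u + u') \<otimes> v = u \<otimes> v + u' \<otimes> v" "u \<otimes> (v + v') = u \<otimes> v + u \<otimes> v'"
    by (fact *)+
  show "(u - u') \<otimes> v = u \<otimes> v - u' \<otimes> v" "u \<otimes> (v - v') = u \<otimes> v - u \<otimes> v'"
    using *(1)[of "u - u'" u' v] *(2)[of u "v - v'" v'] by (simp_all add: algebra_simps)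
  show "scale c u \<otimes> v = fscale c (u \<otimes> v)" "u \<otimes> scale c v = fscale c (u \<otimes> v)"
    using bilinear_tens2[OF vector_space_scale] unfolding bilinear_map_iff by blast+
qed

text \<open>
  Both sides of the left Alia coalgebra axiom are values of this one trilinear map: with
  \<open>\<Delta> x\<^sub>(\<^sub>1\<^sub>) = x\<^sub>1\<^sub>1 \<otimes> x\<^sub>1\<^sub>2\<close>, the left-hand side is its value at \<open>(x\<^sub>1\<^sub>2, x\<^sub>1\<^sub>1, x\<^sub>2)\<close> and the right-hand
  side its value at \<open>(x\<^sub>1\<^sub>1, x\<^sub>1\<^sub>2, x\<^sub>2)\<close>. Its invariance under rotation replaces all bookkeeping of
  tensor positions.
\<close>

definition cyclic_tensor :: "'a \<Rightarrow> 'a \<Rightarrow> 'a \<Rightarrow> ('a, 'k) tensor3"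
  where "cyclic_tensor u v w = tens3 scale u v w + tens3 scale v w u + tens3 scale w u v"

lemma cyclic_tensor_rotate: "cyclic_tensor u v w = cyclic_tensor v w u"
  by (simp add: cyclic_tensor_def algebra_simps)

lemma trilinear_cyclic_tensor: "trilinear_map scale fscale cyclic_tensor"
  using trilinear_tens3[OF vector_space_scale]
  unfolding trilinear_map_iff cyclic_tensor_def by (simp add: fscale_simps algebra_simps)

lemmas cyclic_tensor_simps =
  trilinear_cyclic_tensor[unfolded trilinear_map_iff, THEN conjunct2, THEN conjunct2, rule_format]
  trilinear_map_diff[OF trilinear_cyclic_tensor]

lemma bilinear_map_pullback:
  assumes "bilinear_map scale fscale F"
    and "Vector_Spaces.linear scale scale f" "Vector_Spaces.linear scale scale g"
  shows "bilinear_map scale fscale (\<lambda>u v. F (f u) (g v))"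
  using assms unfolding bilinear_map_iff linear_iff by simp

lemma linear_ident: "Vector_Spaces.linear scale scale (\<lambda>z. z)"
  and linear_id: "Vector_Spaces.linear scale scale id"
  and linear_br: "Vector_Spaces.linear scale scale (\<lambda>z. br z x)"
  and linear_comm: "Vector_Spaces.linear scale scale (\<lambda>z. comm z x)"
  by (simp_all add: linear_iff vector_space_scale br_simps algebra_simps)

lemma linear_compose:
  assumes "Vector_Spaces.linear scale scale f" "Vector_Spaces.linear scale scale g"
  shows "Vector_Spaces.linear scale scale (\<lambda>z. f (g z))"
  using assms unfolding linear_iff by simp

lemmas bilinear_tensor = bilinear_map_pullback[OF bilinear_tens2[OF vector_space_scale]]

end


section \<open>Coboundaries of antisymmetric tensors\<close>

locale antisymmetric_left_alia = left_alia_algebra scale br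
  for scale :: "'k::field_char_0 \<Rightarrow> 'a::ab_group_add \<Rightarrow> 'a" and br +
  fixes I :: "'i set" and a b :: "'i \<Rightarrow> 'a"
  assumes antisymmetric: "antisymmetric_tensor scale (tensor_sum scale I a b)"
begin

abbreviation cobr :: "'a \<Rightarrow> ('a, 'k) tensor2"
  where "cobr \<equiv> coboundary scale br I a b"

lemma ext2_tensor_sum:
  assumes "bilinear_map scale fscale F"
  shows "ext2 F (tensor_sum scale I a b) = (\<Sum>i\<in>I. F (a i) (b i))"
  unfolding tensor_sum_def ext2_sum using ext2_tens2[OF assms] by simp

text \<open>
  Evaluation of \<open>r + \<tau> r = 0\<close> on a bilinear map: within a sum over the presentation, the two
  legs of \<open>r\<close> may be exchanged at the cost of a sign.
\<close>

lemma skew: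
  assumes "bilinear_map scale fscale F"
  shows "(\<Sum>i\<in>I. F (b i) (a i)) = - (\<Sum>i\<in>I. F (a i) (b i))"
proof -
  let ?r = "tensor_sum scale I a b"
  have flip: "flip scale ?r = (\<Sum>i\<in>I. b i \<otimes> a i)"
    unfolding flip_def
    by (rule ext2_tensor_sum) (auto simp: bilinear_map_iff vector_space_scale vector_space_fscale tensor_simps)
  have "ext2 F (flip scale ?r) = (\<Sum>i\<in>I. F (b i) (a i))"
    unfolding flip ext2_sum using ext2_tens2[OF assms] by simp
  moreover have "flip scale ?r = 0 - ?r"
    using antisymmetric unfolding antisymmetric_tensor_def by (simp add: eq_neg_iff_add_eq_0 add.commute)
  then have "ext2 F (flip scale ?r) = - ext2 F ?r"
    by (simp add: ext2_diff ext2_def fun_eq_iff)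
  ultimately show ?thesis using ext2_tensor_sum[OF assms] by simp
qed

lemma ext2_coboundary:
  assumes "bilinear_map scale fscale F"
  shows "ext2 F (cobr x) = (\<Sum>i\<in>I. F (comm (a i) x) (b i) - F (a i) (br (b i) x))"
  unfolding coboundary_def ext2_sum ext2_diff using ext2_tens2[OF assms] by simp

lemma coboundary_in: "cobr x \<in> tensor2_space scale"
proof -
  interpret V: vector_space "fscale :: 'k \<Rightarrow> ('a, 'k) tensor2 \<Rightarrow> _" by (rule vector_space_fscale)
  have "u \<otimes> v \<in> tensor2_space scale" for u v
    unfolding tensor2_space_def by (rule V.span_base) blast
  then show ?thesis
    unfolding coboundary_def tensor2_space_def by (intro V.span_sum V.span_diff)
qed

lemma coboundary_linear: "Vector_Spaces.linear scale fscale cobr"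
  unfolding linear_iff coboundary_def
  by (simp add: vector_space_scale vector_space_fscale br_simps tensor_simps fscale_simps
      sum.distrib sum_subtractf)

text \<open>
  Antisymmetrizing the coproduct cancels half of each commutator, so that only left
  multiplication by \<open>z\<close> survives, acting as a derivation on the two legs of \<open>r\<close>.
\<close>

lemma flip_minus_coboundary:
  "flip scale (cobr z) - cobr z = (\<Sum>i\<in>I. br z (a i) \<otimes> b i + a i \<otimes> br z (b i))"
proof -
  have "flip scale (cobr z) = (\<Sum>i\<in>I. b i \<otimes> comm (a i) z - br (b i) z \<otimes> a i)"
    unfolding flip_def
    by (rule ext2_coboundary)
      (auto simp: bilinear_map_iff vector_space_scale vector_space_fscale tensor_simps)
  also have "\<dots> = (\<Sum>i\<in>I. br (a i) z \<otimes> b i - a i \<otimes> comm (b i) z)"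
    using skew[OF bilinear_tensor[OF linear_ident linear_comm], of z]
      skew[OF bilinear_tensor[OF linear_br linear_ident], of z]
    by (simp add: sum_subtractf)
  finally show ?thesis
    by (simp add: coboundary_def tensor_simps algebra_simps flip: sum_subtractf sum.distrib)
qed

text \<open>
  After antisymmetrization the terms \<open>ay \<otimes> bx\<close> and \<open>ax \<otimes> by\<close> on the right-hand side cancel.
  What is left lives in one tensor factor at a time and is the left Alia identity for
  \<open>x\<close>, \<open>y\<close> and a leg of \<open>r\<close>.
\<close>

lemma coboundary_compatible:
  "flip scale (cobr (comm x y)) - cobr (comm x y)
   = flip scale (tensor_map scale (\<lambda>z. br z y) id (cobr x) - tensor_map scale (\<lambda>z. br z x) id (cobr y))
     - (tensor_map scale (\<lambda>z. br z y) id (cobr x) - tensor_map scale (\<lambda>z. br z x) id (cobr y))"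
proof -
  have map: "tensor_map scale (\<lambda>z. br z y) id (cobr x)
      = (\<Sum>i\<in>I. br (comm (a i) x) y \<otimes> b i - br (a i) y \<otimes> br (b i) x)" for x y
    unfolding tensor_map_def
    using ext2_coboundary[OF bilinear_tensor[OF linear_br[of y] linear_id]] by simp
  let ?E = "tensor_map scale (\<lambda>z. br z y) id (cobr x) - tensor_map scale (\<lambda>z. br z x) id (cobr y)"
  have "flip scale ?E = (\<Sum>i\<in>I. b i \<otimes> br (comm (a i) x) y - br (b i) x \<otimes> br (a i) y
      - (b i \<otimes> br (comm (a i) y) x - br (b i) y \<otimes> br (a i) x))"
    unfolding map flip_def ext2_diff ext2_sum sum_subtractf[symmetric]
      flip_tens2[OF vector_space_scale, unfolded flip_def] ..
  also have "\<dots> = (\<Sum>i\<in>I. a i \<otimes> br (comm (b i) y) x + br (a i) x \<otimes> br (b i) y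
      - (a i \<otimes> br (comm (b i) x) y + br (a i) y \<otimes> br (b i) x))"
    using skew[OF bilinear_tensor[OF linear_ident linear_compose[OF linear_br linear_comm]], of y x]
      skew[OF bilinear_tensor[OF linear_ident linear_compose[OF linear_br linear_comm]], of x y]
      skew[OF bilinear_tensor[OF linear_br linear_br], of x y]
      skew[OF bilinear_tensor[OF linear_br linear_br], of y x]
    by (simp add: sum_subtractf sum.distrib)
  finally have "flip scale ?E - ?E
      = (\<Sum>i\<in>I. (br (comm (a i) y) x - br (comm (a i) x) y) \<otimes> b i
          + a i \<otimes> (br (comm (b i) y) x - br (comm (b i) x) y))"
    unfolding map
    by (simp add: tensor_simps algebra_simps flip: sum_subtractf sum.distrib)
  moreover have "br (comm z y) x - br (comm z x) y = br (comm x y) z" for z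
    using left_alia_comm[of x y z] by (simp add: br_simps algebra_simps)
  ultimately show ?thesis
    unfolding flip_minus_coboundary by simp
qed

end


section \<open>The Yang-Baxter equation\<close>

locale alia_yang_baxter = antisymmetric_left_alia scale br I a b
  for scale :: "'k::field_char_0 \<Rightarrow> 'a::ab_group_add \<Rightarrow> 'a" and br
    and I :: "'i set" and a b :: "'i \<Rightarrow> 'a" +
  assumes yang_baxter: "(\<Sum>i\<in>I. \<Sum>j\<in>I.
        tens3 scale (br (a i) (a j)) (b i) (b j)
      + tens3 scale (a i) (br (a j) (b i) - br (b i) (a j)) (b j)
      - tens3 scale (a i) (a j) (br (b j) (b i))) = 0"
begin

text \<open>
  The equation between tensors is one between functionals on trilinear forms. A trilinear map
  \<open>T\<close> with values in functionals gives, at each argument \<open>\<beta>\<close>, such a form.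
\<close>

lemma yang_baxter_trilinear:
  assumes T: "trilinear_map scale fscale T"
  shows "(\<Sum>i\<in>I. \<Sum>j\<in>I. T (br (a i) (a j)) (b i) (b j) + T (a i) (comm (a j) (b i)) (b j)
      - T (a i) (a j) (br (b j) (b i))) = 0"
proof
  fix \<beta>
  have "trilinear_map scale (*) (\<lambda>u v w. T u v w \<beta>)"
    using T vector_space_field unfolding trilinear_map_iff by (simp add: fscale_def)
  moreover have ev: "(\<Sum>i\<in>I. g i) \<phi> = (\<Sum>i\<in>I. g i \<phi>)" for g :: "'i \<Rightarrow> 'x \<Rightarrow> 'k" and \<phi>
    by (induction I rule: infinite_finite_induct) auto
  ultimately show "(\<Sum>i\<in>I. \<Sum>j\<in>I. T (br (a i) (a j)) (b i) (b j) + T (a i) (comm (a j) (b i)) (b j)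
      - T (a i) (a j) (br (b j) (b i))) \<beta> = 0 \<beta>"
    using fun_cong[OF yang_baxter, of "\<lambda>u v w. T u v w \<beta>"]
    by (simp add: ev tens3_def)
qed

text \<open>
  With \<open>\<Gamma>\<close> for the cyclic tensor, the difference of the two sides consists of
  \<open>A1 = \<Sum> \<Gamma>(c(a\<^sub>j,x)a\<^sub>i, b\<^sub>i, b\<^sub>j)\<close>, \<open>A2 = \<Sum> \<Gamma>(a\<^sub>i, c(a\<^sub>j,x)b\<^sub>i, b\<^sub>j)\<close>,
  \<open>A3 = \<Sum> \<Gamma>(a\<^sub>ja\<^sub>i, b\<^sub>i, b\<^sub>jx)\<close> and \<open>A4 = \<Sum> \<Gamma>(a\<^sub>i, a\<^sub>jb\<^sub>i, b\<^sub>jx)\<close>, combined as \<open>A1 + A2 - A3 - A4\<close>.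
  The element \<open>x\<close> is inside the commutator in the first two terms but outside the products in
  the last two; the left Alia identity moves it out, since \<open>A1 + A2\<close> is the sum of
  \<open>-\<Gamma>(c(a\<^sub>i,a\<^sub>j)x, b\<^sub>i, b\<^sub>j)\<close>. The expression is then the Yang-Baxter equation evaluated on
  \<open>(u, v, w) \<mapsto> \<Gamma>(w, u, vx)\<close>, term by term.
\<close>

lemma coboundary_left_coalia:
  "ext2 (\<lambda>x1 x2. ext2 (\<lambda>x11 x12.
      tens3 scale x12 x11 x2 + tens3 scale x11 x2 x12 + tens3 scale x2 x12 x11) (cobr x1)) (cobr x)
   = ext2 (\<lambda>x1 x2. ext2 (\<lambda>x11 x12.
      tens3 scale x11 x12 x2 + tens3 scale x12 x2 x11 + tens3 scale x2 x11 x12) (cobr x1)) (cobr x)"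
    (is "?L = ?R")
proof -
  let ?\<Gamma> = cyclic_tensor
  note \<Gamma> = cyclic_tensor_simps
  have bil: "bilinear_map scale fscale (\<lambda>u v. ?\<Gamma> u v w)"
    "bilinear_map scale fscale (\<lambda>u v. ?\<Gamma> v u w)" for w
    by (auto simp: bilinear_map_iff vector_space_scale vector_space_fscale \<Gamma>)
  define L where "L z w = (\<Sum>i\<in>I. ?\<Gamma> (b i) (comm (a i) z) w - ?\<Gamma> (br (b i) z) (a i) w)" for z w
  define R where "R z w = (\<Sum>i\<in>I. ?\<Gamma> (comm (a i) z) (b i) w - ?\<Gamma> (a i) (br (b i) z) w)" for z w
  \<comment> \<open>the cyclic tensor applied to \<open>(\<tau> - id)\<Delta> z \<otimes> w\<close>\<close>
  define D where "D z w = (\<Sum>i\<in>I. ?\<Gamma> (br z (a i)) (b i) w + ?\<Gamma> (a i) (br z (b i)) w)" for z w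
  have L: "(\<lambda>x1 x2. ext2 (\<lambda>x11 x12.
      tens3 scale x12 x11 x2 + tens3 scale x11 x2 x12 + tens3 scale x2 x12 x11) (cobr x1)) = L"
    using ext2_coboundary[OF bil(2)] by (simp add: L_def cyclic_tensor_def fun_eq_iff)
  have R: "(\<lambda>x1 x2. ext2 (\<lambda>x11 x12.
      tens3 scale x11 x12 x2 + tens3 scale x12 x2 x11 + tens3 scale x2 x11 x12) (cobr x1)) = R"
    using ext2_coboundary[OF bil(1)] by (simp add: R_def cyclic_tensor_def fun_eq_iff)
  have bilL: "bilinear_map scale fscale L" and bilR: "bilinear_map scale fscale R"
    unfolding bilinear_map_iff L_def R_def
    by (simp_all add: vector_space_scale vector_space_fscale \<Gamma> br_simps fscale_simps
        flip: sum.distrib) (simp_all add: algebra_simps)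
  have LR: "L z w - R z w = D z w" for z w
  proof -
    have "(\<Sum>i\<in>I. ?\<Gamma> (b i) (comm (a i) z) w) = - (\<Sum>i\<in>I. ?\<Gamma> (a i) (comm (b i) z) w)"
      "(\<Sum>i\<in>I. ?\<Gamma> (br (b i) z) (a i) w) = - (\<Sum>i\<in>I. ?\<Gamma> (br (a i) z) (b i) w)"
      using skew[OF bilinear_map_pullback[OF bil(1)[of w] linear_ident linear_comm], of z]
        skew[OF bilinear_map_pullback[OF bil(1)[of w] linear_br linear_ident], of z] by auto
    then show ?thesis
      unfolding L_def R_def D_def
      by (simp add: \<Gamma> sum_subtractf sum.distrib)
  qed
  have "?L - ?R = (\<Sum>j\<in>I. D (comm (a j) x) (b j) - D (a j) (br (b j) x))"
    unfolding L R ext2_coboundary[OF bilL] ext2_coboundary[OF bilR] LR[symmetric]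
    by (simp add: sum_subtractf)
  also have "\<dots> = (\<Sum>j\<in>I. \<Sum>i\<in>I. ?\<Gamma> (br (comm (a j) x) (a i)) (b i) (b j))
      + (\<Sum>j\<in>I. \<Sum>i\<in>I. ?\<Gamma> (a i) (br (comm (a j) x) (b i)) (b j))
      - (\<Sum>j\<in>I. \<Sum>i\<in>I. ?\<Gamma> (br (a j) (a i)) (b i) (br (b j) x))
      - (\<Sum>j\<in>I. \<Sum>i\<in>I. ?\<Gamma> (a i) (br (a j) (b i)) (br (b j) x))" (is "_ = ?A1 + ?A2 - ?A3 - ?A4")
    unfolding D_def by (simp add: sum_subtractf sum.distrib)
  finally have LR': "?L - ?R = ?A1 + ?A2 - ?A3 - ?A4" .
  have skew': "(\<Sum>i\<in>I. F (a i) (b i)) = - (\<Sum>i\<in>I. F (b i) (a i))"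
    if "bilinear_map scale fscale F" for F :: "'a \<Rightarrow> 'a \<Rightarrow> ('a, 'k) tensor3"
    using skew[OF that] by simp
  note bil_simps = bilinear_map_iff vector_space_scale vector_space_fscale \<Gamma> br_simps fscale_simps
  \<comment> \<open>rotated so that the product comes first, \<open>A2\<close> differs from \<open>A1\<close> by exchanging \<open>i\<close> and
    \<open>j\<close> inside the product, with a sign\<close>
  have A2: "?A2 = - (\<Sum>j\<in>I. \<Sum>i\<in>I. ?\<Gamma> (br (comm (a i) x) (a j)) (b i) (b j))"
  proof -
    have "(\<Sum>i\<in>I. ?\<Gamma> (a i) (br z (b i)) w) = - (\<Sum>i\<in>I. ?\<Gamma> (br z (a i)) w (b i))" for z w
      using skew[of "\<lambda>u v. ?\<Gamma> v (br z u) w"]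
      by (simp add: bil_simps cyclic_tensor_rotate[of _ _ w] cyclic_tensor_rotate[of _ w])
    then have "?A2 = - (\<Sum>j\<in>I. \<Sum>i\<in>I. ?\<Gamma> (br (comm (a j) x) (a i)) (b j) (b i))"
      by (simp add: sum_negf)
    then show ?thesis by (subst sum.swap) simp
  qed
  have A12: "?A1 + ?A2 = - (\<Sum>j\<in>I. \<Sum>i\<in>I. ?\<Gamma> (br (comm (a j) (a i)) x) (b j) (b i))"
  proof -
    have alia: "?\<Gamma> (br (comm q x) p) v w - ?\<Gamma> (br (comm p x) q) v w = - ?\<Gamma> (br (comm p q) x) v w"
      for p q v w
    proof -
      have "br (comm q x) p - br (comm p x) q = 0 - br (comm p q) x"
        using left_alia_comm[of p q x] by (simp add: br_simps algebra_simps)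
      \<comment> \<open>a negative \<open>- z\<close> is written as \<open>z - z - z\<close>, to which additivity of \<open>\<Gamma>\<close> applies\<close>
      then have "?\<Gamma> (br (comm q x) p - br (comm p x) q) v w
          = ?\<Gamma> (br (comm p q) x - br (comm p q) x - br (comm p q) x) v w"
        by simp
      then show ?thesis
        unfolding trilinear_map_diff[OF trilinear_cyclic_tensor] by simp
    qed
    have "?A1 + ?A2 = (\<Sum>j\<in>I. \<Sum>i\<in>I. - ?\<Gamma> (br (comm (a i) (a j)) x) (b i) (b j))"
      unfolding A2 alia[symmetric] sum_subtractf by simp
    also have "\<dots> = - (\<Sum>j\<in>I. \<Sum>i\<in>I. ?\<Gamma> (br (comm (a i) (a j)) x) (b i) (b j))"
      by (simp add: sum_negf)
    finally show ?thesis by (subst sum.swap)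
  qed
  have "(\<Sum>i\<in>I. \<Sum>j\<in>I. ?\<Gamma> (b j) (br (a i) (a j)) (br (b i) x)
      + ?\<Gamma> (b j) (a i) (br (comm (a j) (b i)) x) - ?\<Gamma> (br (b j) (b i)) (a i) (br (a j) x)) = 0"
    using yang_baxter_trilinear[of "\<lambda>u v w. ?\<Gamma> w u (br v x)"]
    by (simp add: trilinear_map_iff vector_space_scale vector_space_fscale \<Gamma> br_simps)
  then have Y: "(\<Sum>i\<in>I. \<Sum>j\<in>I. ?\<Gamma> (b j) (br (a i) (a j)) (br (b i) x))
      + (\<Sum>i\<in>I. \<Sum>j\<in>I. ?\<Gamma> (b j) (a i) (br (comm (a j) (b i)) x))
      - (\<Sum>i\<in>I. \<Sum>j\<in>I. ?\<Gamma> (br (b j) (b i)) (a i) (br (a j) x)) = 0" (is "?Y1 + ?Y2 - ?Y3 = 0")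
    unfolding sum.distrib sum_subtractf .
  have Y1: "?Y1 = - ?A4"
  proof -
    have "(\<Sum>j\<in>I. ?\<Gamma> (b j) (br z (a j)) w) = - (\<Sum>j\<in>I. ?\<Gamma> (a j) (br z (b j)) w)" for z w
      using skew'[of "\<lambda>u v. ?\<Gamma> v (br z u) w"] by (simp add: bil_simps)
    then show ?thesis by (simp add: sum_negf)
  qed
  have Y2: "?Y2 = ?A1 + ?A2"
  proof -
    have "(\<Sum>i\<in>I. ?\<Gamma> w (a i) (br (comm z (b i)) x))
        = - (\<Sum>i\<in>I. ?\<Gamma> (br (comm z (a i)) x) w (b i))" for z w
      using skew'[of "\<lambda>u v. ?\<Gamma> w u (br (comm z v) x)"]
      by (simp add: bil_simps cyclic_tensor_rotate[of w] cyclic_tensor_rotate[of _ w])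
    then show ?thesis unfolding A12 by (subst sum.swap) (simp add: sum_negf)
  qed
  have Y3: "?Y3 = ?A3"
  proof -
    have "(\<Sum>j\<in>I. ?\<Gamma> (br (b j) z) w (br (a j) x))
        = - (\<Sum>j\<in>I. ?\<Gamma> (br (a j) z) w (br (b j) x))" for z w
      using skew'[of "\<lambda>u v. ?\<Gamma> (br v z) w (br u x)"] by (simp add: bil_simps)
    then have "?Y3 = - (\<Sum>j\<in>I. \<Sum>i\<in>I. ?\<Gamma> (br (a j) (b i)) (a i) (br (b j) x))"
      by (subst sum.swap) (simp add: sum_negf)
    moreover have "(\<Sum>i\<in>I. ?\<Gamma> (br z (b i)) (a i) w)
        = - (\<Sum>i\<in>I. ?\<Gamma> (br z (a i)) (b i) w)" for z w
      using skew'[of "\<lambda>u v. ?\<Gamma> (br z v) u w"] by (simp add: bil_simps)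
    ultimately show ?thesis by (simp add: sum_negf)
  qed
  have "?L - ?R = 0"
    using Y unfolding LR' Y1 Y2 Y3 by (simp add: algebra_simps)
  then show ?thesis by simp
qed

end


section \<open>Nijenhuis operators\<close>

locale intertwined_left_alia =
  antisymmetric_left_alia scale br I a b + adjoint_admissible_nijenhuis_left_alia_algebra scale br N S
  for scale :: "'k::field_char_0 \<Rightarrow> 'a::ab_group_add \<Rightarrow> 'a" and br
    and I :: "'i set" and a b :: "'i \<Rightarrow> 'a" and N S +
  assumes intertwining:
    "tensor_map scale S id (tensor_sum scale I a b) = tensor_map scale id N (tensor_sum scale I a b)"
begin

lemma N_simps: "N (x + y) = N x + N y" "N (x - y) = N x - N y" "N (scale c x) = scale c (N x)"
  using N_linear linear_diff[OF N_linear] unfolding linear_iff by auto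

lemma S_simps: "S (x + y) = S x + S y" "S (x - y) = S x - S y" "S (scale c x) = scale c (S x)"
  using S_linear linear_diff[OF S_linear] unfolding linear_iff by auto

lemma shift_S:
  assumes F: "bilinear_map scale fscale F"
  shows "(\<Sum>i\<in>I. F (S (a i)) (b i)) = (\<Sum>i\<in>I. F (a i) (N (b i)))"
proof -
  have "tensor_map scale S id (tensor_sum scale I a b) = (\<Sum>i\<in>I. S (a i) \<otimes> b i)"
    "tensor_map scale id N (tensor_sum scale I a b) = (\<Sum>i\<in>I. a i \<otimes> N (b i))"
    unfolding tensor_map_def
    using ext2_tensor_sum[OF bilinear_tensor[OF S_linear linear_id]]
      ext2_tensor_sum[OF bilinear_tensor[OF linear_id N_linear]] by simp_all
  then have "ext2 F (\<Sum>i\<in>I. S (a i) \<otimes> b i) = ext2 F (\<Sum>i\<in>I. a i \<otimes> N (b i))"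
    using intertwining by simp
  then show ?thesis by (simp add: ext2_sum ext2_tens2[OF F])
qed

text \<open>
  Two exchanges of the legs turn the intertwining relation around; their signs cancel.
\<close>

lemma shift_N:
  assumes F: "bilinear_map scale fscale F"
  shows "(\<Sum>i\<in>I. F (N (a i)) (b i)) = (\<Sum>i\<in>I. F (a i) (S (b i)))"
proof -
  have F': "bilinear_map scale fscale (\<lambda>u v. F v u)"
    using F by (auto simp: bilinear_map_iff)
  show ?thesis
    using shift_S[OF F'] skew[OF bilinear_map_pullback[OF F N_linear linear_ident]]
      skew[OF bilinear_map_pullback[OF F linear_ident S_linear]]
    by simp
qed

lemma ext2_coboundary_tensor:
  assumes "Vector_Spaces.linear scale scale f" "Vector_Spaces.linear scale scale g"
  shows "ext2 (\<lambda>x1 x2. f x1 \<otimes> g x2) (cobr x)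
    = (\<Sum>i\<in>I. f (comm (a i) x) \<otimes> g (b i)) - (\<Sum>i\<in>I. f (a i) \<otimes> g (br (b i) x))"
  by (simp add: ext2_coboundary[OF bilinear_tensor[OF assms]] sum_subtractf)

text \<open>
  The identities for brackets antisymmetrize to identities for commutators. For the first two
  this takes both admissibility conditions, because exchanging the arguments of the bracket
  exchanges the left condition with the right one.
\<close>

lemma admissible_comm:
  "S (comm (N u) x) + comm u (S (S x)) = S (comm u (S x)) + comm (N u) (S x)"
  "S (comm u (N x)) + comm (S (S u)) x = S (comm (S u) x) + comm (S u) (N x)"
  "comm (N u) (N x) + N (N (comm u x)) = N (comm (N u) x) + N (comm u (N x))"
  using admissible_left[of u x] admissible_right[of x u] admissible_left[of x u]
    admissible_right[of u x] nijenhuis[of u x] nijenhuis[of x u]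
  by (simp_all add: S_simps N_simps algebra_simps)

text \<open>
  The common shape of the three conditions below once all operators have been shifted: \<open>f\<close>, \<open>g\<close>,
  \<open>h\<close>, \<open>k\<close> collect the terms in which the second leg of \<open>r\<close> is bare, the primed maps those in
  which the first leg is.
\<close>

lemma tensor_sum_regroup:
  assumes "\<And>u. f u + g u = h u + k u" "\<And>u. f' u + g' u = h' u + k' u"
  shows "(\<Sum>i\<in>I. f (a i) \<otimes> b i) + (\<Sum>i\<in>I. g (a i) \<otimes> b i)
      - ((\<Sum>i\<in>I. a i \<otimes> f' (b i)) + (\<Sum>i\<in>I. a i \<otimes> g' (b i)))
    = (\<Sum>i\<in>I. h (a i) \<otimes> b i) + (\<Sum>i\<in>I. k (a i) \<otimes> b i)
      - ((\<Sum>i\<in>I. a i \<otimes> h' (b i)) + (\<Sum>i\<in>I. a i \<otimes> k' (b i)))"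
  using assms by (simp flip: sum.distrib tensor_simps(1,2))

text \<open>
  In the next three proofs, the rules for terms containing a commutator clear the second leg of
  operators and the other rules clear the first leg.
\<close>

lemma coboundary_conijenhuis:
  "ext2 (\<lambda>x1 x2. S x1 \<otimes> S x2) (cobr x) + cobr (S (S x))
   = ext2 (\<lambda>x1 x2. S x1 \<otimes> x2) (cobr (S x)) + ext2 (\<lambda>x1 x2. x1 \<otimes> S x2) (cobr (S x))"
proof -
  have cobr: "cobr (S (S x))
      = (\<Sum>i\<in>I. comm (a i) (S (S x)) \<otimes> b i) - (\<Sum>i\<in>I. a i \<otimes> br (b i) (S (S x)))"
    by (simp add: coboundary_def sum_subtractf)
  show ?thesis
    unfolding cobr ext2_coboundary_tensor[OF S_linear S_linear]
      ext2_coboundary_tensor[OF S_linear linear_ident] ext2_coboundary_tensor[OF linear_ident S_linear]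
      shift_N[OF bilinear_tensor[OF linear_compose[OF S_linear linear_comm] linear_ident], symmetric]
      shift_S[OF bilinear_tensor[OF linear_ident linear_compose[OF S_linear linear_br]]]
      shift_N[OF bilinear_tensor[OF linear_comm linear_ident], symmetric]
      shift_S[OF bilinear_tensor[OF linear_ident linear_br]]
    using tensor_sum_regroup[of "\<lambda>u. S (comm (N u) x)" "\<lambda>u. comm u (S (S x))"
        "\<lambda>u. S (comm u (S x))" "\<lambda>u. comm (N u) (S x)"
        "\<lambda>u. S (br (N u) x)" "\<lambda>u. br u (S (S x))" "\<lambda>u. S (br u (S x))" "\<lambda>u. br (N u) (S x)",
        OF admissible_comm(1) admissible_left]
    by (simp add: algebra_simps)
qed

lemma coboundary_coadmissible_left:
  "ext2 (\<lambda>x1 x2. S x1 \<otimes> x2) (cobr (N x)) + ext2 (\<lambda>x1 x2. x1 \<otimes> N (N x2)) (cobr x)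
   = ext2 (\<lambda>x1 x2. S x1 \<otimes> N x2) (cobr x) + ext2 (\<lambda>x1 x2. x1 \<otimes> N x2) (cobr (N x))"
  unfolding ext2_coboundary_tensor[OF S_linear linear_ident] ext2_coboundary_tensor[OF S_linear N_linear]
    ext2_coboundary_tensor[OF linear_ident linear_compose[OF N_linear N_linear]]
    ext2_coboundary_tensor[OF linear_ident N_linear]
    shift_S[OF bilinear_tensor[OF linear_comm N_linear], symmetric]
    shift_S[OF bilinear_tensor[OF linear_compose[OF linear_comm S_linear] linear_ident], symmetric]
    shift_S[OF bilinear_tensor[OF linear_comm linear_ident], symmetric]
    shift_S[OF bilinear_tensor[OF linear_compose[OF S_linear linear_comm] linear_ident], symmetric]
    shift_S[OF bilinear_tensor[OF linear_ident linear_br]]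
    shift_S[OF bilinear_tensor[OF linear_ident linear_compose[OF N_linear linear_br]]]
  using tensor_sum_regroup[of "\<lambda>u. S (comm u (N x))" "\<lambda>u. comm (S (S u)) x"
      "\<lambda>u. S (comm (S u) x)" "\<lambda>u. comm (S u) (N x)"
      "\<lambda>u. br (N u) (N x)" "\<lambda>u. N (N (br u x))" "\<lambda>u. N (br (N u) x)" "\<lambda>u. N (br u (N x))",
      OF admissible_comm(2) nijenhuis[unfolded N_simps]]
  by (simp add: algebra_simps)

lemma coboundary_coadmissible_right:
  "ext2 (\<lambda>x1 x2. x1 \<otimes> S x2) (cobr (N x)) + ext2 (\<lambda>x1 x2. N (N x1) \<otimes> x2) (cobr x)
   = ext2 (\<lambda>x1 x2. N x1 \<otimes> S x2) (cobr x) + ext2 (\<lambda>x1 x2. N x1 \<otimes> x2) (cobr (N x))"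
  unfolding ext2_coboundary_tensor[OF linear_ident S_linear]
    ext2_coboundary_tensor[OF linear_compose[OF N_linear N_linear] linear_ident]
    ext2_coboundary_tensor[OF N_linear S_linear] ext2_coboundary_tensor[OF N_linear linear_ident]
    shift_N[OF bilinear_tensor[OF linear_comm linear_ident], symmetric]
    shift_N[OF bilinear_tensor[OF N_linear linear_br]]
    shift_N[OF bilinear_tensor[OF linear_ident linear_compose[OF linear_br S_linear]]]
    shift_N[OF bilinear_tensor[OF linear_compose[OF N_linear linear_comm] linear_ident], symmetric]
    shift_N[OF bilinear_tensor[OF linear_ident linear_compose[OF S_linear linear_br]]]
    shift_N[OF bilinear_tensor[OF linear_ident linear_br]]
  using tensor_sum_regroup[of "\<lambda>u. comm (N u) (N x)" "\<lambda>u. N (N (comm u x))"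
      "\<lambda>u. N (comm (N u) x)" "\<lambda>u. N (comm u (N x))"
      "\<lambda>u. S (br u (N x))" "\<lambda>u. br (S (S u)) x" "\<lambda>u. S (br (S u) x)" "\<lambda>u. br (S u) (N x)",
      OF admissible_comm(3)[unfolded N_simps(1)] admissible_right]
  by (simp add: algebra_simps)

end

theorem proposition3p10:
  fixes scale :: "'k::field_char_0 \<Rightarrow> 'a::ab_group_add \<Rightarrow> 'a"
    and br :: "'a \<Rightarrow> 'a \<Rightarrow> 'a" and N S :: "'a \<Rightarrow> 'a"
    and I :: "'i set" and a b :: "'i \<Rightarrow> 'a"
  assumes "adjoint_admissible_nijenhuis_left_alia_algebra scale br N S"
    and "finite I"
    and "antisymmetric_tensor scale (tensor_sum scale I a b)"
    and "admissible_alia_YBE scale br N S I a b"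
  shows "nijenhuis_left_alia_bialgebra scale br (coboundary scale br I a b) N S"
proof -
  interpret A: adjoint_admissible_nijenhuis_left_alia_algebra scale br N S by fact
  interpret alia_yang_baxter scale br I a b
    using assms(3,4) unfolding admissible_alia_YBE_def by unfold_locales simp_all
  interpret intertwined_left_alia scale br I a b N S
    using assms(4) unfolding admissible_alia_YBE_def by unfold_locales simp_all
  show ?thesis
    by (intro nijenhuis_left_alia_bialgebra.intro nijenhuis_left_alia_bialgebra_axioms.intro
        left_alia_bialgebra.intro left_alia_bialgebra_axioms.intro
        left_alia_coalgebra.intro left_alia_coalgebra_axioms.intro)
      (fact coboundary_in coboundary_linear coboundary_left_coalia coboundary_compatible
        coboundary_conijenhuis coboundary_coadmissible_left coboundary_coadmissible_right
        A.left_alia_algebra_axioms A.adjoint_admissible_nijenhuis_left_alia_algebra_axioms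
        A.vector_space_scale)+
qed

end
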